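(* For any $0 < m \le M < \infty$ there is no nonnegative, Lebesgue measurable function $f:\mathbb{R}^2 \to \mathbb{R}$ such that for every strip $S$ in the plane, of any width $R > 0$, $$m R \le \int_S f \le M R.$$
   Context: A strip of width $R>0$ in the plane is the region between two parallel lines at distance $R$, i.e. a set of the form $\{x \in \mathbb{R}^2 : a \le x \cdot u \le a + R\}$ with $u$ a unit vector in $\mathbb{R}^2$ and $a \in \mathbb{R}$. The integral $\int_S f$ is with respect to two-dimensional Lebesgue measure. *)

theory Defs
  imports "HOL-Analysis.Analysis"
begin

definition is_strip :: "real \<Rightarrow> (real ^ 2) set \<Rightarrow> bool" where
  "is_strip R S \<longleftrightarrow> R > 0 \<and> (\<exists>u a. norm u = 1 \<and> S = {x. a \<le> x \<bullet> u \<and> x \<bullet> u \<le> a + R})"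

end

theory Submission
  imports Defs
begin

text \<open>
  Averaging the strips centred at the origin over their direction turns the strip bounds into
  bounds for \<open>\<integral> f(x) \<phi>\<^sub>R(x) dx\<close>, where \<open>\<phi>\<^sub>R(x)\<close> measures the set of directions whose strip of
  half-width \<open>R\<close> contains \<open>x\<close> and is comparable to \<open>min(1, R/|x|)\<close>. The upper bound for \<open>R = 1\<close>
  gives \<open>\<integral> f(x) min(1, 1/|x|) dx < \<infinity>\<close>, whereas the lower bound gives
  \<open>\<integral> f(x) min(1/R, 1/|x|) dx \<ge> c > 0\<close> for all \<open>R\<close>. As \<open>R\<close> tends to infinity this contradicts
  dominated convergence.
\<close>

section \<open>Strips centred at the origin and sweeps over their slopes\<close>

text \<open>Allows directions given by vectors that are not normalised, so that a sweep can run over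
  \<open>(1, t)\<close> instead of an angle; the price is a width that depends on
  \<open>norm v\<close>.\<close>

lemma is_strip_symmetric:
  fixes v :: "real ^ 2"
  assumes "v \<noteq> 0" "R > 0"
  shows "is_strip (2 * R / norm v) {x. \<bar>x \<bullet> v\<bar> \<le> R}"
proof -
  have eq: "{x. \<bar>x \<bullet> v\<bar> \<le> R} = {x. - (R / norm v) \<le> x \<bullet> (v /\<^sub>R norm v) \<and>
      x \<bullet> (v /\<^sub>R norm v) \<le> - (R / norm v) + 2 * R / norm v}"
    using assms by (auto simp: field_simps abs_le_iff)
  show ?thesis
    unfolding is_strip_def eq using assms
    by (intro conjI exI[of _ "v /\<^sub>R norm v"] exI[of _ "- (R / norm v)"]) auto
qed

lemma borel_measurable_vec_nth [measurable (raw)]: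
  fixes f :: "'a \<Rightarrow> real ^ 'n"
  assumes "f \<in> borel_measurable N"
  shows "(\<lambda>x. f x $ i) \<in> borel_measurable N"
  using assms by (rule borel_measurable_continuous_on[rotated]) (intro continuous_intros)

text \<open>Tonelli's theorem: both sides integrate \<open>g x\<close> over the pairs of
  \<open>x\<close> and \<open>t\<close> with \<open>x\<close> in the strip of parameter
  \<open>t\<close>. Lebesgue measure in \<open>t\<close> replaces the average over angles.\<close>

lemma strip_mass_sweep:
  fixes g :: "real ^ 2 \<Rightarrow> ennreal"
  assumes [measurable]: "g \<in> borel_measurable borel"
  shows "(\<integral>\<^sup>+t\<in>{a..b}. (\<integral>\<^sup>+x\<in>{x. \<bar>x $ i + t * x $ j\<bar> \<le> R}. g x \<partial>lborel) \<partial>lborel) =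
    (\<integral>\<^sup>+x. g x * emeasure lborel {t \<in> {a..b}. \<bar>x $ i + t * x $ j\<bar> \<le> R} \<partial>lborel)"
proof -
  let ?F = "\<lambda>x t. g x * indicator {t \<in> {a..b}. \<bar>x $ i + t * x $ j\<bar> \<le> R} t"
  have [measurable]: "Measurable.pred (borel \<Otimes>\<^sub>M borel)
      (\<lambda>(x :: real ^ 2, t :: real). t \<in> {t \<in> {a..b}. \<bar>x $ i + t * x $ j\<bar> \<le> R})"
    unfolding mem_Collect_eq by measurable
  have "(\<integral>\<^sup>+t\<in>{a..b}. (\<integral>\<^sup>+x\<in>{x. \<bar>x $ i + t * x $ j\<bar> \<le> R}. g x \<partial>lborel) \<partial>lborel) =
      (\<integral>\<^sup>+t. (\<integral>\<^sup>+x. ?F x t \<partial>lborel) \<partial>lborel)"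
    by (subst nn_integral_multc[symmetric])
       (auto intro!: nn_integral_cong simp: indicator_def)
  also have "\<dots> = (\<integral>\<^sup>+x. (\<integral>\<^sup>+t. ?F x t \<partial>lborel) \<partial>lborel)"
    by (rule lborel_pair.Fubini') measurable
  also have "\<dots> = (\<integral>\<^sup>+x. g x * emeasure lborel {t \<in> {a..b}. \<bar>x $ i + t * x $ j\<bar> \<le> R} \<partial>lborel)"
    by (intro nn_integral_cong nn_integral_cmult_indicator) measurable
  finally show ?thesis .
qed

section \<open>Lengths of the sets of parameters whose strip contains a given point\<close>

text \<open>Since \<open>\<bar>p\<bar> \<le> \<bar>q\<bar>\<close>, the map \<open>p + t * q\<close>
  has a zero in \<open>[-1, 1]\<close>. It changes at rate \<open>\<bar>q\<bar>\<close>, so it stays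
  within \<open>[-1, 1]\<close> up to distance \<open>1 / max 1 \<bar>q\<bar>\<close> from that
  zero.\<close>

lemma sweep_length_ge:
  fixes p q :: real
  assumes "\<bar>p\<bar> \<le> \<bar>q\<bar>"
  shows "ennreal (1 / max 1 \<bar>q\<bar>) \<le> emeasure lborel {t \<in> {-1..1}. \<bar>p + t * q\<bar> \<le> 1}"
proof -
  define s where "s = 1 / max 1 \<bar>q\<bar>"
  \<comment> \<open>For \<open>q = 0\<close> the assumption forces \<open>p = 0\<close>, and
    division by zero yields \<open>t\<^sub>0 = 0\<close>, which is again a zero of the map.\<close>
  define t\<^sub>0 where "t\<^sub>0 = - p / q"
  have s: "0 < s" "s \<le> 1" "\<bar>q\<bar> * s \<le> 1"
    by (auto simp: s_def max_def field_simps)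
  have t\<^sub>0: "\<bar>t\<^sub>0\<bar> \<le> 1"
    using assms by (auto simp: t\<^sub>0_def field_simps divide_le_eq_1)
  have near: "\<bar>p + t * q\<bar> \<le> 1" if "\<bar>t - t\<^sub>0\<bar> \<le> s" for t
  proof -
    have "p + t * q = q * (t - t\<^sub>0)"
      using assms by (cases "q = 0") (auto simp: t\<^sub>0_def field_simps)
    hence "\<bar>p + t * q\<bar> = \<bar>q\<bar> * \<bar>t - t\<^sub>0\<bar>" by (simp add: abs_mult)
    also have "\<dots> \<le> \<bar>q\<bar> * s" using that by (intro mult_left_mono) auto
    finally show ?thesis using s by linarith
  qed
  \<comment> \<open>the half of the interval around \<open>t\<^sub>0\<close> that points towards \<open>0\<close> stays inside \<open>[-1, 1]\<close>\<close>
  obtain c where c: "{c..c + s} \<subseteq> {t \<in> {-1..1}. \<bar>p + t * q\<bar> \<le> 1}"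
  proof (cases "t\<^sub>0 \<le> 0")
    case True
    show ?thesis by (rule that[of t\<^sub>0]) (use True t\<^sub>0 s near in auto)
  next
    case False
    show ?thesis by (rule that[of "t\<^sub>0 - s"]) (use False t\<^sub>0 s near in auto)
  qed
  have "ennreal s = emeasure lborel {c..c + s}"
    using s by simp
  also have "\<dots> \<le> emeasure lborel {t \<in> {-1..1}. \<bar>p + t * q\<bar> \<le> 1}"
    using c by (rule emeasure_mono) measurable
  finally show ?thesis by (simp add: s_def)
qed

text \<open>If \<open>q\<close> dominates, the admissible \<open>t\<close> lie in an interval of
  length \<open>2 * R / \<bar>q\<bar>\<close>. If \<open>p\<close> dominates,
  \<open>\<bar>t\<bar> \<le> 1/2\<close> keeps \<open>\<bar>p + t * q\<bar>\<close> at least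
  \<open>\<bar>p\<bar> / 2\<close>, so the set is empty once \<open>\<bar>p\<bar> > 2 * R\<close>,
  and before that the bound \<open>1\<close> suffices.\<close>

lemma sweep_length_le:
  fixes p q R :: real
  assumes "R > 0" and nonzero: "max \<bar>p\<bar> \<bar>q\<bar> > 0"
  shows "emeasure lborel {t \<in> {-1/2..1/2}. \<bar>p + t * q\<bar> \<le> R}
    \<le> ennreal (min 1 (2 * R / max \<bar>p\<bar> \<bar>q\<bar>))"
proof -
  let ?T = "{t \<in> {-1/2..1/2}. \<bar>p + t * q\<bar> \<le> R}"
  have "emeasure lborel ?T \<le> emeasure lborel {-1/2..1/2::real}"
    by (rule emeasure_mono) auto
  hence le_1: "emeasure lborel ?T \<le> ennreal 1" by simp
  have "emeasure lborel ?T \<le> ennreal (2 * R / max \<bar>p\<bar> \<bar>q\<bar>)"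
  proof (cases "\<bar>p\<bar> \<le> \<bar>q\<bar>")
    case True
    with nonzero have q: "q \<noteq> 0" by auto
    have "?T \<subseteq> {- p / q - R / \<bar>q\<bar>..- p / q + R / \<bar>q\<bar>}"
    proof
      fix t assume "t \<in> ?T"
      hence "\<bar>p + t * q\<bar> / \<bar>q\<bar> \<le> R / \<bar>q\<bar>" by (intro divide_right_mono) auto
      moreover have "\<bar>p + t * q\<bar> / \<bar>q\<bar> = \<bar>t - (- p / q)\<bar>"
        using q by (simp add: abs_divide[symmetric] add_divide_distrib add.commute)
      ultimately have "\<bar>t - (- p / q)\<bar> \<le> R / \<bar>q\<bar>" by simp
      thus "t \<in> {- p / q - R / \<bar>q\<bar>..- p / q + R / \<bar>q\<bar>}"
        unfolding abs_le_iff atLeastAtMost_iff by linarith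
    qed
    hence "emeasure lborel ?T \<le> emeasure lborel {- p / q - R / \<bar>q\<bar>..- p / q + R / \<bar>q\<bar>}"
      by (rule emeasure_mono) auto
    also have "\<dots> = ennreal (2 * R / \<bar>q\<bar>)"
      using assms by (subst emeasure_lborel_Icc) (auto intro: divide_nonneg_nonneg)
    finally show ?thesis using True by (simp add: max_def)
  next
    case False
    show ?thesis
    proof (cases "\<bar>p\<bar> \<le> 2 * R")
      case True
      hence "1 \<le> 2 * R / max \<bar>p\<bar> \<bar>q\<bar>" using False by (simp add: max_def field_simps)
      thus ?thesis using le_1 by (meson ennreal_leI order_trans)
    next
      case far: False
      have "\<bar>p + t * q\<bar> > R" if "t \<in> {-1/2..1/2}" for t
      proof -
        have "\<bar>t * q\<bar> \<le> 1/2 * \<bar>p\<bar>"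
          unfolding abs_mult using that False by (intro mult_mono) auto
        thus ?thesis using far by linarith
      qed
      hence "?T = {}" by force
      thus ?thesis by (simp only: emeasure_empty zero_le)
    qed
  qed
  with le_1 show ?thesis by (simp add: min_def)
qed

section \<open>Contradiction for a Borel measurable density\<close>

lemma no_borel_density:
  fixes g :: "real ^ 2 \<Rightarrow> real" and m M :: real
  assumes [measurable]: "g \<in> borel_measurable borel" and "0 < m"
    and lower: "\<And>R S. is_strip R S \<Longrightarrow> ennreal (m * R) \<le> (\<integral>\<^sup>+x\<in>S. ennreal (g x) \<partial>lborel)"
    and upper: "\<And>R S. is_strip R S \<Longrightarrow> (\<integral>\<^sup>+x\<in>S. ennreal (g x) \<partial>lborel) \<le> ennreal (M * R)"
  shows False
proof -
  \<comment> \<open>The two bounds on a single strip of width 1 give \<open>m \<le> M\<close>, hence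
    \<open>M > 0\<close>.\<close>
  have "is_strip 1 {x :: real ^ 2. 0 \<le> x \<bullet> axis 1 1 \<and> x \<bullet> axis 1 1 \<le> 0 + 1}"
    unfolding is_strip_def by (intro conjI exI[of _ "axis 1 1 :: real ^ 2"] exI[of _ 0]) auto
  from order_trans[OF lower[OF this] upper[OF this]] have M: "M > 0"
    using \<open>0 < m\<close> by (auto simp: ennreal_le_iff2)

  \<comment> \<open>This is the weight \<phi> of the overview, with slopes from
    \<open>[-c, c]\<close> in place of angles.\<close>
  define len where "len i j c R x = emeasure lborel {t \<in> {-c..c}. \<bar>x $ i + t * x $ j\<bar> \<le> R}"
    for i j and c R :: real and x :: "real ^ 2"
  have [measurable]: "len i j c R \<in> borel_measurable borel" for i j c R
  proof -
    \<comment> \<open>The value of \<open>len\<close> at \<open>x\<close> is the measure of the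
      section of this set at \<open>x\<close>.\<close>
    have "{y \<in> space (borel \<Otimes>\<^sub>M lborel). snd y \<in> {-c..c} \<and> \<bar>fst y $ i + snd y * fst y $ j\<bar> \<le> R}
        \<in> sets ((borel :: (real ^ 2) measure) \<Otimes>\<^sub>M (lborel :: real measure))"
      by measurable
    from lborel.measurable_emeasure_Pair[OF this] show ?thesis
      by (simp add: len_def[abs_def] space_pair_measure vimage_def)
  qed

  \<comment> \<open>The width is \<open>2 * R / norm v\<close> with
    \<open>1 \<le> norm v \<le> 2\<close>. The upper estimate uses \<open>w \<le> 2 * R\<close>, the
    lower one \<open>R \<le> w\<close>.\<close>
  have strip: "\<exists>w\<in>{R..2 * R}. is_strip w {x. \<bar>x $ i + t * x $ j\<bar> \<le> R}"
    if "i \<noteq> j" "\<bar>t\<bar> \<le> 1" "R > 0" for i j t R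
  proof -
    define v :: "real ^ 2" where "v = axis i 1 + t *\<^sub>R axis j 1"
    have "\<bar>v $ i\<bar> \<le> norm v" by (rule component_le_norm_cart)
    hence v: "1 \<le> norm v" using that by (simp add: v_def axis_def)
    have "norm v \<le> norm (axis i 1 :: real ^ 2) + norm (t *\<^sub>R axis j 1 :: real ^ 2)"
      unfolding v_def by (rule norm_triangle_ineq)
    hence "norm v \<le> 2" using that(2) by simp
    hence "2 * R / 2 \<le> 2 * R / norm v"
      using v that(3) by (intro divide_left_mono) auto
    moreover have "2 * R / norm v \<le> 2 * R / 1"
      using v that(3) by (intro divide_left_mono) auto
    moreover have "x $ i + t * x $ j = x \<bullet> v" for x
      by (simp add: v_def inner_add_right inner_axis)
    moreover have "v \<noteq> 0" using v by auto
    ultimately show ?thesis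
      using is_strip_symmetric[of v R] that(3) by (intro bexI[of _ "2 * R / norm v"]) auto
  qed

  \<comment> \<open>The function min(1, 1/|x|) in the maximum norm, which fits the coordinatewise
    length bounds.\<close>
  define h where "h x = 1 / max 1 (max \<bar>x $ 1\<bar> \<bar>x $ 2\<bar>)" for x :: "real ^ 2"
  have h_pos: "h x > 0" for x by (simp add: h_def)
  have [measurable]: "h \<in> borel_measurable borel" unfolding h_def by measurable

  \<comment> \<open>Each strip has width at most 2, hence mass at most \<open>2 * M\<close>; the
    parameter interval has length 2.\<close>
  have sweep_upper: "(\<integral>\<^sup>+x. ennreal (g x) * len i j 1 1 x \<partial>lborel) \<le> ennreal (4 * M)"
    if "i \<noteq> j" for i j
  proof -
    have "(\<integral>\<^sup>+x. ennreal (g x) * len i j 1 1 x \<partial>lborel) =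
        (\<integral>\<^sup>+t\<in>{-1..1}. (\<integral>\<^sup>+x\<in>{x. \<bar>x $ i + t * x $ j\<bar> \<le> 1}. g x \<partial>lborel) \<partial>lborel)"
      unfolding len_def by (rule strip_mass_sweep[symmetric]) measurable
    also have "\<dots> \<le> (\<integral>\<^sup>+t\<in>{-1..1::real}. ennreal (2 * M) \<partial>lborel)"
    proof (intro nn_integral_mono)
      fix t :: real
      show "(\<integral>\<^sup>+x\<in>{x. \<bar>x $ i + t * x $ j\<bar> \<le> 1}. g x \<partial>lborel) * indicator {-1..1} t
          \<le> ennreal (2 * M) * indicator {-1..1} t"
      proof (cases "t \<in> {-1..1}")
        case True
        hence t: "\<bar>t\<bar> \<le> 1" by auto
        from strip[OF that t zero_less_one] obtain w
          where w: "w \<le> 2" "is_strip w {x. \<bar>x $ i + t * x $ j\<bar> \<le> 1}" by auto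
        have "(\<integral>\<^sup>+x\<in>{x. \<bar>x $ i + t * x $ j\<bar> \<le> 1}. g x \<partial>lborel) \<le> ennreal (M * w)"
          by (rule upper[OF w(2)])
        also have "\<dots> \<le> ennreal (2 * M)"
          using w(1) M by (intro ennreal_leI) simp
        finally show ?thesis using True by simp
      qed simp
    qed
    also have "\<dots> = ennreal (2 * M) * emeasure lborel {-1..1::real}"
      by (rule nn_integral_cmult_indicator) simp
    also have "\<dots> = ennreal (4 * M)"
      using M by (simp add: ennreal_mult'[symmetric] flip: ennreal_numeral)
    finally show ?thesis .
  qed

  have "(\<integral>\<^sup>+x. ennreal (g x) * h x \<partial>lborel)
      \<le> (\<integral>\<^sup>+x. ennreal (g x) * len 1 2 1 1 x + ennreal (g x) * len 2 1 1 1 x \<partial>lborel)"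
  proof (rule nn_integral_mono)
    fix x :: "real ^ 2"
    \<comment> \<open>The sweep whose parameter multiplies the larger coordinate already reaches
      \<open>h x\<close>; adding both sweeps covers every point.\<close>
    have "ennreal (h x) \<le> len 1 2 1 1 x + len 2 1 1 1 x"
    proof (cases "\<bar>x $ 1\<bar> \<le> \<bar>x $ 2\<bar>")
      case True
      thus ?thesis using sweep_length_ge[OF True]
        by (intro add_increasing2) (auto simp: h_def len_def max_absorb2)
    next
      case False
      hence "\<bar>x $ 2\<bar> \<le> \<bar>x $ 1\<bar>" by simp
      thus ?thesis using sweep_length_ge[of "x $ 2" "x $ 1"]
        by (intro add_increasing) (auto simp: h_def len_def max_absorb1)
    qed
    thus "ennreal (g x) * h x \<le> ennreal (g x) * len 1 2 1 1 x + ennreal (g x) * len 2 1 1 1 x"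
      unfolding distrib_left[symmetric] by (intro mult_left_mono) auto
  qed
  also have "\<dots> = (\<integral>\<^sup>+x. ennreal (g x) * len 1 2 1 1 x \<partial>lborel)
      + (\<integral>\<^sup>+x. ennreal (g x) * len 2 1 1 1 x \<partial>lborel)"
    by (rule nn_integral_add) measurable
  also have "\<dots> \<le> ennreal (4 * M) + ennreal (4 * M)"
    by (intro add_mono sweep_upper) auto
  also have "\<dots> < \<infinity>" by (simp add: ennreal_add_eq_top less_top)
  finally have finite_h: "(\<integral>\<^sup>+x. ennreal (g x) * h x \<partial>lborel) < \<infinity>" .

  \<comment> \<open>With \<open>R = Suc n\<close>, this is the density times the upper bound for
    \<open>len 1 2 (1/2) R x / R\<close>; the successor keeps \<open>R\<close> positive.\<close>
  define u where "u n x = ennreal (g x) * ennreal (min (1 / real (Suc n)) (2 * h x))" for n x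
  have u_lower: "ennreal m \<le> (\<integral>\<^sup>+x. u n x \<partial>lborel)" for n
  proof -
    define R where "R = real (Suc n)"
    have R: "R \<ge> 1" by (simp add: R_def)
    have "ennreal (m * R) = (\<integral>\<^sup>+t\<in>{-1/2..1/2::real}. ennreal (m * R) \<partial>lborel)"
      by (subst nn_integral_cmult_indicator) auto
    \<comment> \<open>One sweep is enough here, because the upper bound on its length holds at every
      point. The interval has length 1, so the constant \<open>m * R\<close> is preserved.\<close>
    also have "\<dots> \<le> (\<integral>\<^sup>+t\<in>{-1/2..1/2}. (\<integral>\<^sup>+x\<in>{x. \<bar>x $ 1 + t * x $ 2\<bar> \<le> R}. g x \<partial>lborel) \<partial>lborel)"
    proof (intro nn_integral_mono)
      fix t :: real
      show "ennreal (m * R) * indicator {-1/2..1/2} t \<le>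
          (\<integral>\<^sup>+x\<in>{x. \<bar>x $ 1 + t * x $ 2\<bar> \<le> R}. g x \<partial>lborel) * indicator {-1/2..1/2} t"
      proof (cases "t \<in> {-1/2..1/2}")
        case True
        hence t: "\<bar>t\<bar> \<le> 1" by auto
        have "R > 0" using R by simp
        have ne: "(1 :: 2) \<noteq> 2" by simp
        from strip[OF ne t \<open>R > 0\<close>] obtain w
          where w: "R \<le> w" "is_strip w {x. \<bar>x $ 1 + t * x $ 2\<bar> \<le> R}" by auto
        have "ennreal (m * R) \<le> ennreal (m * w)"
          using w(1) \<open>m > 0\<close> by (intro ennreal_leI) simp
        also have "\<dots> \<le> (\<integral>\<^sup>+x\<in>{x. \<bar>x $ 1 + t * x $ 2\<bar> \<le> R}. g x \<partial>lborel)"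
          by (rule lower[OF w(2)])
        finally show ?thesis using True by simp
      qed simp
    qed
    also have "\<dots> = (\<integral>\<^sup>+x. ennreal (g x) * len 1 2 (1/2) R x \<partial>lborel)"
      unfolding len_def minus_divide_left by (rule strip_mass_sweep) measurable
    also have "\<dots> \<le> (\<integral>\<^sup>+x. ennreal R * u n x \<partial>lborel)"
    proof (rule nn_integral_mono)
      fix x :: "real ^ 2"
      \<comment> \<open>If both coordinates are at most 1 in absolute value, then
        \<open>h x = 1\<close> and the right side is 1, the length of the whole interval. Elsewhere
        \<open>h x\<close> is the reciprocal of the larger one.\<close>
      have "len 1 2 (1/2) R x \<le> ennreal (min 1 (2 * R * h x))"
      proof (cases "max \<bar>x $ 1\<bar> \<bar>x $ 2\<bar> \<le> 1")
        case True
        have "len 1 2 (1/2) R x \<le> emeasure lborel {-(1/2)..1/2::real}"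
          unfolding len_def by (rule emeasure_mono) auto
        moreover have "h x = 1" using True by (simp add: h_def max_def)
        ultimately show ?thesis using R by (simp add: min_def)
      next
        case False
        hence "max 1 (max \<bar>x $ 1\<bar> \<bar>x $ 2\<bar>) = max \<bar>x $ 1\<bar> \<bar>x $ 2\<bar>"
          and "max \<bar>x $ 1\<bar> \<bar>x $ 2\<bar> > 0"
          by linarith+
        thus ?thesis using sweep_length_le[of R "x $ 1" "x $ 2"] R
          by (simp add: len_def h_def)
      qed
      also have "min 1 (2 * R * h x) = R * min (1 / R) (2 * h x)"
        using R by (simp add: min_def field_simps)
      finally have "ennreal (g x) * len 1 2 (1/2) R x
          \<le> ennreal (g x) * (ennreal R * ennreal (min (1 / R) (2 * h x)))"
        using R by (intro mult_left_mono) (auto simp: ennreal_mult')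
      thus "ennreal (g x) * len 1 2 (1/2) R x \<le> ennreal R * u n x"
        by (simp add: u_def R_def mult_ac)
    qed
    also have "\<dots> = ennreal R * (\<integral>\<^sup>+x. u n x \<partial>lborel)"
      by (rule nn_integral_cmult) (unfold u_def, measurable)
    finally have "ennreal R * ennreal m \<le> ennreal R * (\<integral>\<^sup>+x. u n x \<partial>lborel)"
      using R \<open>m > 0\<close> by (simp add: ennreal_mult' mult.commute)
    thus ?thesis using R by (subst (asm) ennreal_mult_le_mult_iff) auto
  qed

  have "(\<lambda>n. \<integral>\<^sup>+x. u n x \<partial>lborel) \<longlonglongrightarrow> (\<integral>\<^sup>+x. 0 \<partial>(lborel :: (real ^ 2) measure))"
  \<comment> \<open>The dominating function does not depend on \<open>n\<close>; its integral is
    finite by the upper strip bound at \<open>R = 1\<close>.\<close>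
  proof (rule nn_integral_dominated_convergence[where w = "\<lambda>x. 2 * (ennreal (g x) * h x)"])
    show "AE x in lborel. u n x \<le> 2 * (ennreal (g x) * h x)" for n
    proof (rule AE_I2)
      fix x :: "real ^ 2"
      have "u n x \<le> ennreal (g x) * ennreal (2 * h x)"
        unfolding u_def by (intro mult_left_mono ennreal_leI) auto
      thus "u n x \<le> 2 * (ennreal (g x) * h x)"
        by (subst (asm) ennreal_mult') (auto simp: mult_ac)
    qed
    show "(\<integral>\<^sup>+x. 2 * (ennreal (g x) * h x) \<partial>lborel) < \<infinity>"
      using finite_h by (subst nn_integral_cmult) (auto simp: ennreal_mult_less_top)
    show "AE x in lborel. (\<lambda>n. u n x) \<longlonglongrightarrow> 0"
    proof (rule AE_I2)
      fix x :: "real ^ 2"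
      have "(\<lambda>n. min (1 / real (Suc n)) (2 * h x)) \<longlonglongrightarrow> min 0 (2 * h x)"
        by (intro tendsto_min tendsto_const LIMSEQ_Suc[OF lim_1_over_n])
      hence "(\<lambda>n. ennreal (min (1 / real (Suc n)) (2 * h x))) \<longlonglongrightarrow> ennreal 0"
        using h_pos[of x] by (intro tendsto_ennrealI) (simp add: min_def)
      hence "(\<lambda>n. u n x) \<longlonglongrightarrow> ennreal (g x) * ennreal 0"
        unfolding u_def by (intro ennreal_tendsto_cmult) auto
      thus "(\<lambda>n. u n x) \<longlonglongrightarrow> 0" by simp
    qed
  qed (unfold u_def, measurable)
  hence "(\<lambda>n. \<integral>\<^sup>+x. u n x \<partial>lborel) \<longlonglongrightarrow> 0" by simp
  hence "ennreal m \<le> 0"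
    by (rule LIMSEQ_le_const) (use u_lower in auto)
  thus False using \<open>m > 0\<close> by simp
qed

theorem corollary2:
  fixes m M :: real
  assumes "0 < m" and "m \<le> M"
  shows "\<not> (\<exists>f :: real ^ 2 \<Rightarrow> real.
            f \<in> borel_measurable lebesgue \<and> (\<forall>x. 0 \<le> f x) \<and>
            (\<forall>R S. is_strip R S \<longrightarrow>
               ennreal (m * R) \<le> (\<integral>\<^sup>+x\<in>S. ennreal (f x) \<partial>lebesgue) \<and>
               (\<integral>\<^sup>+x\<in>S. ennreal (f x) \<partial>lebesgue) \<le> ennreal (M * R)))"
proof
  assume "\<exists>f :: real ^ 2 \<Rightarrow> real.
            f \<in> borel_measurable lebesgue \<and> (\<forall>x. 0 \<le> f x) \<and>
            (\<forall>R S. is_strip R S \<longrightarrow>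
               ennreal (m * R) \<le> (\<integral>\<^sup>+x\<in>S. ennreal (f x) \<partial>lebesgue) \<and>
               (\<integral>\<^sup>+x\<in>S. ennreal (f x) \<partial>lebesgue) \<le> ennreal (M * R))"
  then obtain f :: "real ^ 2 \<Rightarrow> real" where f: "f \<in> borel_measurable lebesgue"
    and strips: "\<And>R S. is_strip R S \<Longrightarrow>
               ennreal (m * R) \<le> (\<integral>\<^sup>+x\<in>S. ennreal (f x) \<partial>lebesgue) \<and>
               (\<integral>\<^sup>+x\<in>S. ennreal (f x) \<partial>lebesgue) \<le> ennreal (M * R)"
    by blast
  \<comment> \<open>Exchanging the integrals in the sweep requires Borel measurability. Changing
    \<open>f\<close> on a null set leaves all strip integrals unchanged.\<close>
  obtain g where g: "g \<in> borel_measurable lborel" and fg: "AE x in lborel. f x = g x"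
    using completion_ex_borel_measurable_real[OF f] by auto
  have [measurable]: "g \<in> borel_measurable borel" using g by simp
  have mass: "(\<integral>\<^sup>+x\<in>S. ennreal (f x) \<partial>lebesgue) = (\<integral>\<^sup>+x\<in>S. ennreal (g x) \<partial>lborel)"
    if "is_strip R S" for R S
  proof -
    from that obtain u a where S: "S = {x. a \<le> x \<bullet> u \<and> x \<bullet> u \<le> a + R}"
      by (auto simp: is_strip_def)
    have [measurable]: "S \<in> sets borel" unfolding S by measurable
    have "(\<integral>\<^sup>+x\<in>S. ennreal (f x) \<partial>lebesgue) = (\<integral>\<^sup>+x\<in>S. ennreal (g x) \<partial>lebesgue)"
      by (rule nn_integral_cong_AE) (use AE_completion[OF fg] in auto)
    also have "\<dots> = (\<integral>\<^sup>+x\<in>S. ennreal (g x) \<partial>lborel)"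
      by (rule nn_integral_completion)
    finally show ?thesis .
  qed
  show False
    by (rule no_borel_density[of g m M]) (use strips mass \<open>0 < m\<close> in auto)
qed

end
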